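(* Let $\mathcal J$ be an ideal on $\omega$. (1) The following conditions are equivalent: (a) $\mathcal J$ is extendable to a selective ideal (i.e. $\mathcal J\subseteq\mathcal J'$ for some selective ideal $\mathcal J'$ on $\omega$); (b) $\mathcal{ED}\not\preceq^{\omega_1}_{\omega^\omega,1-1}\mathcal J$; (c) $\mathcal{ED}\not\preceq^{\omega_1}_{\omega^\omega,\mathrm{Fin}-1}\mathcal J$; (d) $\mathcal{ED}\not\preceq^{\omega_1}_{\omega^\omega,\omega^\omega}\mathcal J$. (2) Under CH, the conditions (a), (b), (c), (d) listed in (1) are equivalent to each of the following: (e) there is a selective ultrafilter which is not a $\mathcal J$-point; (f) there is a selective ultrafilter which is not a weak $\mathcal J$-ultrafilter; (g) there is a selective ultrafilter which is not a $\mathcal J$-ultrafilter.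
   Context: An ideal on a set $X$ is a family of subsets of $X$ closed under finite unions and subsets, containing all finite subsets of $X$ and not containing $X$; $\mathcal J^+=\mathcal P(X)\setminus\mathcal J$. Ideals on countably infinite sets are regarded as ideals on $\omega$ via fixed bijections. $\mathcal{ED}=\{A\subseteq\omega\times\omega:\exists m$ such that for all but finitely many $n$, $|\{k:(n,k)\in A\}|<m\}$. $\mathcal J$ is a selective ideal if for every decreasing sequence $(A_n)_{n\in\omega}$ of sets in $\mathcal J^+$ there is $A\in\mathcal J^+$, $A\subseteq A_0$, such that $|A\cap(A_n\setminus A_{n+1})|\le1$ for every $n$. For $\mathcal F\subseteq\omega^\omega$ and ideals $\mathcal I,\mathcal K$ on $\omega$, $\mathcal I\le_{\mathcal F}\mathcal K$ means that there is $f\in\mathcal F$ with $f^{-1}[B]\in\mathcal K$ for every $B\in\mathcal I$. $\mathrm{Fin}-1$ and $1-1$ denote the families of all finite-to-one, respectively one-to-one, functions $\omega\to\omega$. For an ideal $\mathcal K$ on $\omega$ and $\mathcal A\subseteq\mathcal P(\omega)$, $\mathcal K(\mathcal A)=\{B\subseteq\omega:\exists F\in[\mathcal A]^{<\omega}\ (B\setminus\bigcup F\in\mathcal K)\}$. $\mathcal I\preceq^{\omega_1}_{\mathcal F,\mathcal G}\mathcal J$ means: for each ideal $\mathcal J'$ on $\omega$ with $\mathcal J\le_{\mathcal G}\mathcal J'$ there is a countable $\mathcal A\subseteq\mathcal P(\omega)$ with $\omega\notin\mathcal J'(\mathcal A)$ and $\mathcal I\le_{\mathcal F}\mathcal J'(\mathcal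 A)$. Ultrafilters on $\omega$ contain all cofinite sets; $\mathcal U^*=\{\omega\setminus A:A\in\mathcal U\}$. $\mathcal U$ is a selective (Ramsey) ultrafilter if $\mathcal U^*$ is a selective ideal. $\mathcal U$ is a $\mathcal J$-ultrafilter (weak $\mathcal J$-ultrafilter, $\mathcal J$-point) if $\mathcal J\not\le_{\mathcal F}\mathcal U^*$ for $\mathcal F=\omega^\omega$ ($\mathrm{Fin}-1$, $1-1$, respectively). *)

theory Defs
  imports Main "HOL-Library.Countable_Set" "HOL-Library.Nat_Bijection"
begin

definition ideal_on :: "'a set \<Rightarrow> 'a set set \<Rightarrow> bool" where
  "ideal_on X \<I> \<longleftrightarrow>
     \<I> \<subseteq> Pow X \<and>
     (\<forall>A\<in>\<I>. \<forall>B\<in>\<I>. A \<union> B \<in> \<I>) \<and>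
     (\<forall>A\<in>\<I>. \<forall>B. B \<subseteq> A \<longrightarrow> B \<in> \<I>) \<and>
     (\<forall>A. A \<subseteq> X \<and> finite A \<longrightarrow> A \<in> \<I>) \<and>
     X \<notin> \<I>"

abbreviation ideal_omega :: "nat set set \<Rightarrow> bool" where
  "ideal_omega \<I> \<equiv> ideal_on UNIV \<I>"

definition positive :: "nat set set \<Rightarrow> nat set set" where
  "positive \<J> = UNIV - \<J>"

definition selective_ideal :: "nat set set \<Rightarrow> bool" where
  "selective_ideal \<J> \<longleftrightarrow>
     ideal_omega \<J> \<and>
     (\<forall>A :: nat \<Rightarrow> nat set. (\<forall>n. A (Suc n) \<subseteq> A n) \<and> (\<forall>n. A n \<in> positive \<J>) \<longrightarrow>
        (\<exists>S\<in>positive \<J>. S \<subseteq> A 0 \<and>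
           (\<forall>n. finite (S \<inter> (A n - A (Suc n))) \<and> card (S \<inter> (A n - A (Suc n))) \<le> 1)))"

definition ED_plane :: "(nat \<times> nat) set set" where
  "ED_plane =
     {A. \<exists>m. \<exists>N. finite N \<and>
        (\<forall>n. n \<notin> N \<longrightarrow> finite {k. (n, k) \<in> A} \<and> card {k. (n, k) \<in> A} < m)}"

text \<open>The copy of \<^const>\<open>ED_plane\<close> on \<open>\<omega>\<close>, along the pairing bijection \<^const>\<open>prod_encode\<close>.\<close>
definition ED :: "nat set set" where
  "ED = (\<lambda>A. prod_encode ` A) ` ED_plane"

definition fin_to_one :: "(nat \<Rightarrow> nat) set" where
  "fin_to_one = {f. \<forall>y. finite (f -` {y})}"

definition one_to_one :: "(nat \<Rightarrow> nat) set" where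
  "one_to_one = {f. inj f}"

definition le_via :: "(nat \<Rightarrow> nat) set \<Rightarrow> nat set set \<Rightarrow> nat set set \<Rightarrow> bool" where
  "le_via F \<I> \<K> \<longleftrightarrow> (\<exists>f\<in>F. \<forall>B\<in>\<I>. f -` B \<in> \<K>)"

text \<open>\<open>\<K>(\<A>)\<close>; it need not be a proper ideal, as it may contain \<open>\<omega>\<close>.\<close>
definition ideal_extension :: "nat set set \<Rightarrow> nat set set \<Rightarrow> nat set set" where
  "ideal_extension \<K> \<A> = {B. \<exists>F. finite F \<and> F \<subseteq> \<A> \<and> B - \<Union>F \<in> \<K>}"

text \<open>\<open>preceq_omega1 F G \<I> \<J>\<close> is \<open>\<I> \<preceq> \<J>\<close> with superscript \<open>\<omega>\<^sub>1\<close> and subscripts \<open>F, G\<close>.\<close>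
definition preceq_omega1 ::
  "(nat \<Rightarrow> nat) set \<Rightarrow> (nat \<Rightarrow> nat) set \<Rightarrow> nat set set \<Rightarrow> nat set set \<Rightarrow> bool" where
  "preceq_omega1 F G \<I> \<J> \<longleftrightarrow>
     (\<forall>\<J>'. ideal_omega \<J>' \<and> le_via G \<J> \<J>' \<longrightarrow>
        (\<exists>\<A>. countable \<A> \<and> UNIV \<notin> ideal_extension \<J>' \<A> \<and>
              le_via F \<I> (ideal_extension \<J>' \<A>)))"

text \<open>Since all cofinite sets are required to be members, these are the free ultrafilters.\<close>
definition ultrafilter_omega :: "nat set set \<Rightarrow> bool" where
  "ultrafilter_omega \<U> \<longleftrightarrow>
     {} \<notin> \<U> \<and>
     (\<forall>A\<in>\<U>. \<forall>B\<in>\<U>. A \<inter> B \<in> \<U>) \<and>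
     (\<forall>A\<in>\<U>. \<forall>B. A \<subseteq> B \<longrightarrow> B \<in> \<U>) \<and>
     (\<forall>A. A \<in> \<U> \<or> - A \<in> \<U>) \<and>
     (\<forall>A. finite (- A) \<longrightarrow> A \<in> \<U>)"

definition dual_ideal :: "nat set set \<Rightarrow> nat set set" where
  "dual_ideal \<U> = {- A | A. A \<in> \<U>}"

definition selective_ultrafilter :: "nat set set \<Rightarrow> bool" where
  "selective_ultrafilter \<U> \<longleftrightarrow> ultrafilter_omega \<U> \<and> selective_ideal (dual_ideal \<U>)"

text \<open>The following three are predicates on ultrafilters \<open>\<U>\<close>, relative to an ideal \<open>\<J>\<close>.\<close>
definition J_ultrafilter :: "nat set set \<Rightarrow> nat set set \<Rightarrow> bool" where
  "J_ultrafilter \<J> \<U> \<longleftrightarrow> \<not> le_via UNIV \<J> (dual_ideal \<U>)"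

definition weak_J_ultrafilter :: "nat set set \<Rightarrow> nat set set \<Rightarrow> bool" where
  "weak_J_ultrafilter \<J> \<U> \<longleftrightarrow> \<not> le_via fin_to_one \<J> (dual_ideal \<U>)"

definition J_point :: "nat set set \<Rightarrow> nat set set \<Rightarrow> bool" where
  "J_point \<J> \<U> \<longleftrightarrow> \<not> le_via one_to_one \<J> (dual_ideal \<U>)"

definition extendable_to_selective :: "nat set set \<Rightarrow> bool" where
  "extendable_to_selective \<J> \<longleftrightarrow> (\<exists>\<J>'. selective_ideal \<J>' \<and> \<J> \<subseteq> \<J>')"

text \<open>\<open>CH\<close> in the form: the cardinal of the power set of \<open>\<omega>\<close> is the successor cardinal of \<open>\<omega>\<close>.\<close>
definition CH :: bool where
  "CH \<longleftrightarrow> (card_of (UNIV :: nat set set), cardSuc natLeq) \<in> ordIso"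

end

theory Submission
  imports Defs "HOL-Library.Countable_Set_Type"
begin

text \<open>
  Everything rests on one observation. An ideal \<open>\<K>\<close> fails to lie above \<^const>\<open>ED\<close> exactly if every
  \<open>g : \<omega> \<rightarrow> \<omega>\<close> all of whose fibres lie in \<open>\<K>\<close> is injective on some \<open>\<K>\<close>-positive set
  (\<open>ED_below_iff\<close>): \<^const>\<open>ED\<close> is generated by the vertical lines, which become the
  fibres of \<open>g\<close>, and by graphs of functions, which become sets on which \<open>g\<close> is injective.

  A selective ideal \<open>\<K>\<close> keeps this property when countably many sets are added to it. Selectivity
  yields a positive set almost disjoint from all the added sets and from all the fibres,
  and, applied once more, a positive subset of it on which \<open>g\<close> is injective; such a set remains
  positive after the extension (\<open>selective_extension_not_above_ED\<close>). Conversely, let \<open>\<K>\<close> have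
  this property for all its proper countable extensions, and let \<open>(A\<^sub>n)\<close> be a decreasing sequence of
  positive sets. Adding the complements of the \<open>A\<^sub>n\<close> puts the differences \<open>A\<^sub>n - A\<^bsub>n+1\<^esub>\<close> into the ideal,
  so that they are the fibres to which the property applies: \<open>\<K>\<close> is selective
  (\<open>selective_if_extensions_not_above_ED\<close>). Thus the failure of
  \<open>ED \<preceq> \<J>\<close> says precisely that some selective ideal lies above \<open>\<J>\<close> by a map of the given kind.
  The kind of map is irrelevant: if \<open>f\<close> witnesses \<open>\<J> \<le> \<K>\<close> with \<open>\<K>\<close> selective, then \<open>f\<close> is injective on
  a positive set \<open>S\<close>, and the image under \<open>f\<close> of the restriction of \<open>\<K>\<close> to \<open>S\<close> is a selective ideal
  containing \<open>\<J>\<close> (\<open>extendable_if_below_selective\<close>).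

  The dual ideal of a selective ultrafilter is selective, so the same argument shows that (g)
  implies (a). For the converse let \<open>\<J>'\<close> be a selective ideal containing \<open>\<J>\<close>.
  The \<open>\<J>'\<close>-positive sets are \<open>\<sigma>\<close>-closed under almost inclusion, and every
  \<open>f : \<omega> \<rightarrow> \<omega>\<close> is constant or injective on a positive subset of any given positive set. Under CH the
  functions \<open>f\<close> can be listed in type \<open>\<omega>\<^sub>1\<close>, and a recursion of that length gives an almost decreasing
  chain of positive sets that decides all of them. The chain generates a selective ultrafilter
  whose dual ideal contains \<open>\<J>'\<close> (\<open>CH_selective_ultrafilter_extending\<close>), so that the identity is a
  one-to-one witness.
\<close>

section \<open>Ideals and their extensions\<close>

lemma positive_iff [simp]: "A \<in> positive \<J> \<longleftrightarrow> A \<notin> \<J>"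
  by (simp add: positive_def)

lemma ideal_Un: "ideal_omega \<J> \<Longrightarrow> A \<in> \<J> \<Longrightarrow> B \<in> \<J> \<Longrightarrow> A \<union> B \<in> \<J>"
  by (simp add: ideal_on_def)

lemma ideal_subset: "ideal_omega \<J> \<Longrightarrow> A \<in> \<J> \<Longrightarrow> B \<subseteq> A \<Longrightarrow> B \<in> \<J>"
  unfolding ideal_on_def by blast

lemma ideal_finite: "ideal_omega \<J> \<Longrightarrow> finite A \<Longrightarrow> A \<in> \<J>"
  by (simp add: ideal_on_def)

lemma ideal_UNIV: "ideal_omega \<J> \<Longrightarrow> UNIV \<notin> \<J>"
  by (simp add: ideal_on_def)

lemma ideal_UN:
  assumes "ideal_omega \<J>" "finite I" "\<And>i. i \<in> I \<Longrightarrow> B i \<in> \<J>"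
  shows "(\<Union>i\<in>I. B i) \<in> \<J>"
  using assms(2,3)
proof (induction I)
  case empty
  then show ?case using ideal_finite[OF assms(1)] by simp
next
  case (insert i I)
  then show ?case using ideal_Un[OF assms(1), of "B i"] by simp
qed

lemma ideal_almost_subset:
  assumes "ideal_omega \<J>" "B \<in> \<J>" "finite (A - B)"
  shows "A \<in> \<J>"
proof -
  have "B \<union> (A - B) \<in> \<J>"
    by (rule ideal_Un[OF assms(1,2) ideal_finite[OF assms(1,3)]])
  then show ?thesis
    by (rule ideal_subset[OF assms(1)]) blast
qed

lemma ideal_extension_superset: "\<K> \<subseteq> ideal_extension \<K> \<A>"
proof
  fix B assume "B \<in> \<K>"
  then have "finite {} \<and> {} \<subseteq> \<A> \<and> B - \<Union>{} \<in> \<K>" by simp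
  then show "B \<in> ideal_extension \<K> \<A>"
    unfolding ideal_extension_def by blast
qed

lemma ideal_extension_generators:
  assumes "ideal_omega \<K>"
  shows "\<A> \<subseteq> ideal_extension \<K> \<A>"
proof
  fix a assume "a \<in> \<A>"
  then show "a \<in> ideal_extension \<K> \<A>"
    using ideal_finite[OF assms, of "{}"]
    unfolding ideal_extension_def by (auto intro!: exI[of _ "{a}"])
qed

lemma ideal_extension_ideal:
  assumes \<K>: "ideal_omega \<K>" and proper: "UNIV \<notin> ideal_extension \<K> \<A>"
  shows "ideal_omega (ideal_extension \<K> \<A>)"
  unfolding ideal_on_def
proof (intro conjI ballI allI impI)
  fix A B assume "A \<in> ideal_extension \<K> \<A>" "B \<in> ideal_extension \<K> \<A>"
  then obtain F G where F: "finite F" "F \<subseteq> \<A>" "A - \<Union>F \<in> \<K>" and G: "finite G" "G \<subseteq> \<A>" "B - \<Union>G \<in> \<K>"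
    unfolding ideal_extension_def by blast
  have "A \<union> B - \<Union>(F \<union> G) \<in> \<K>"
    by (rule ideal_subset[OF \<K> ideal_Un[OF \<K> F(3) G(3)]]) blast
  then show "A \<union> B \<in> ideal_extension \<K> \<A>"
    unfolding ideal_extension_def using F G by (auto intro!: exI[of _ "F \<union> G"])
next
  fix A B assume "A \<in> ideal_extension \<K> \<A>" "B \<subseteq> A"
  then obtain F where F: "finite F" "F \<subseteq> \<A>" "A - \<Union>F \<in> \<K>"
    unfolding ideal_extension_def by blast
  have "B - \<Union>F \<in> \<K>"
    by (rule ideal_subset[OF \<K> F(3)]) (use \<open>B \<subseteq> A\<close> in blast)
  then show "B \<in> ideal_extension \<K> \<A>"
    unfolding ideal_extension_def using F by blast
next
  fix A :: "nat set" assume "A \<subseteq> UNIV \<and> finite A"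
  then show "A \<in> ideal_extension \<K> \<A>"
    using ideal_finite[OF \<K>] ideal_extension_superset by blast
qed (use proper in auto)

section \<open>Ideals above ED\<close>

text \<open>
  Vertical lines and graphs of functions lie in \<^const>\<open>ED\<close>, so the first coordinate of a witness for
  \<open>ED \<le> \<K>\<close> is a function \<open>g\<close> as on the right. Conversely \<open>x \<mapsto> (g x, x)\<close> is a witness: outside
  finitely many fibres of \<open>g\<close>, which lie in \<open>\<K>\<close> together, the preimage of a set in \<^const>\<open>ED\<close> has
  fewer than \<open>m\<close> points in each fibre, and numbering them splits this part of the preimage into
  \<open>m\<close> sets on which \<open>g\<close> is injective.
\<close>

lemma ED_below_iff:
  assumes \<K>: "ideal_omega \<K>"
  shows "le_via UNIV ED \<K> \<longleftrightarrow>
    (\<exists>g :: nat \<Rightarrow> nat. (\<forall>n. g -` {n} \<in> \<K>) \<and> (\<forall>T. inj_on g T \<longrightarrow> T \<in> \<K>))"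
proof
  assume "le_via UNIV ED \<K>"
  then obtain h where h: "\<And>B. B \<in> ED \<Longrightarrow> h -` B \<in> \<K>"
    unfolding le_via_def by blast
  define g where "g = (\<lambda>x. fst (prod_decode (h x)))"
  have in_ED: "{x. prod_decode (h x) \<in> D} \<in> \<K>" if "D \<in> ED_plane" for D
  proof -
    have "{x. prod_decode (h x) \<in> D} = h -` (prod_encode ` D)"
      by (auto simp: image_iff) (metis prod_decode_inverse)
    with that h show ?thesis by (auto simp: ED_def)
  qed
  have "g -` {n} \<in> \<K>" for n
  proof -
    have "{p :: nat \<times> nat. fst p = n} \<in> ED_plane"
      unfolding ED_plane_def by (auto intro!: exI[of _ "Suc 0"] exI[of _ "{n}"])
    from in_ED[OF this] show ?thesis
      by (simp add: g_def vimage_def)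
  qed
  moreover have "T \<in> \<K>" if inj: "inj_on g T" for T
  proof -
    define D where "D = (\<lambda>x. prod_decode (h x)) ` T"
    have sub: "\<exists>k0. {k. (n, k) \<in> D} \<subseteq> {k0}" for n
    proof (cases "\<exists>x\<in>T. g x = n")
      case True
      then obtain x where x: "x \<in> T" "g x = n" by blast
      have "k = snd (prod_decode (h x))" if "(n, k) \<in> D" for k
      proof -
        from that obtain y where y: "y \<in> T" "prod_decode (h y) = (n, k)"
          unfolding D_def by (metis imageE)
        then have "g y = n" by (simp add: g_def)
        with inj x y have "y = x" by (auto dest: inj_onD)
        with y show ?thesis by simp
      qed
      then show ?thesis by blast
    next
      case False
      then show ?thesis unfolding D_def g_def by (metis (mono_tags, lifting) empty_iff fst_conv imageE mem_Collect_eq subsetI)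
    qed
    have "finite {k. (n, k) \<in> D} \<and> card {k. (n, k) \<in> D} < 2" for n
    proof -
      obtain k0 where k0: "{k. (n, k) \<in> D} \<subseteq> {k0}" using sub by blast
      with card_mono[OF _ k0] show ?thesis
        by (auto intro: finite_subset)
    qed
    then have "D \<in> ED_plane"
      unfolding ED_plane_def by (auto intro!: exI[of _ 2] exI[of _ "{}"])
    from in_ED[OF this] show ?thesis
      by (rule ideal_subset[OF \<K>]) (auto simp: D_def)
  qed
  ultimately show "\<exists>g :: nat \<Rightarrow> nat. (\<forall>n. g -` {n} \<in> \<K>) \<and> (\<forall>T. inj_on g T \<longrightarrow> T \<in> \<K>)"
    by blast
next
  assume "\<exists>g :: nat \<Rightarrow> nat. (\<forall>n. g -` {n} \<in> \<K>) \<and> (\<forall>T. inj_on g T \<longrightarrow> T \<in> \<K>)"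
  then obtain g :: "nat \<Rightarrow> nat" where fibre: "\<And>n. g -` {n} \<in> \<K>" and inj: "\<And>T. inj_on g T \<Longrightarrow> T \<in> \<K>"
    by blast
  have "(\<lambda>x. prod_encode (g x, x)) -` B \<in> \<K>" if "B \<in> ED" for B
  proof -
    from that obtain D where "D \<in> ED_plane" and B: "B = prod_encode ` D"
      unfolding ED_def by blast
    then obtain m N where N: "finite N"
      and fin: "\<And>n. n \<notin> N \<Longrightarrow> finite {k. (n, k) \<in> D}"
      and less: "\<And>n. n \<notin> N \<Longrightarrow> card {k. (n, k) \<in> D} < m"
      unfolding ED_plane_def by blast
    define E where "E = {x. g x \<notin> N \<and> (g x, x) \<in> D}"
    define lower where "lower = (\<lambda>x. {y \<in> E. g y = g x \<and> y < x})"
    \<comment> \<open>the points of \<open>E\<close> in the fibre through \<open>x\<close> are numbered in increasing order\<close>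
    have "card (lower x) < m" if "x \<in> E" for x
    proof -
      have "g x \<notin> N" using that by (simp add: E_def)
      moreover have "lower x \<subseteq> {k. (g x, k) \<in> D}"
        by (auto simp: lower_def E_def)
      ultimately show ?thesis
        using fin less card_mono by (meson le_less_trans)
    qed
    then have E: "E \<subseteq> (\<Union>i<m. {x \<in> E. card (lower x) = i})" by blast
    have "inj_on g {x \<in> E. card (lower x) = i}" for i
    proof -
      have "card (lower x) < card (lower y)" if "x \<in> E" "y \<in> E" "g x = g y" "x < y" for x y
      proof (rule psubset_card_mono)
        show "finite (lower y)" by (simp add: lower_def)
        show "lower x \<subset> lower y" using that by (auto simp: lower_def)
      qed
      then show ?thesis
        by (intro inj_onI) (metis (mono_tags, lifting) less_irrefl linorder_neqE_nat mem_Collect_eq)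
    qed
    then have "(\<Union>i<m. {x \<in> E. card (lower x) = i}) \<in> \<K>"
      by (intro ideal_UN[OF \<K>] inj) auto
    then have "E \<in> \<K>" using E by (rule ideal_subset[OF \<K>])
    moreover have "(\<Union>n\<in>N. g -` {n}) \<in> \<K>"
      by (intro ideal_UN[OF \<K> N] fibre)
    ultimately have "E \<union> (\<Union>n\<in>N. g -` {n}) \<in> \<K>"
      by (rule ideal_Un[OF \<K>])
    then show ?thesis
      by (rule ideal_subset[OF \<K>]) (auto simp: E_def B)
  qed
  then show "le_via UNIV ED \<K>"
    unfolding le_via_def by blast
qed

section \<open>Selective ideals\<close>

lemma selective_idealD:
  assumes "selective_ideal \<K>" "\<And>n. A (Suc n) \<subseteq> A n" "\<And>n. A n \<notin> \<K>"
  obtains S where "S \<notin> \<K>" "S \<subseteq> A 0"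
    "\<And>n. finite (S \<inter> (A n - A (Suc n)))" "\<And>n. card (S \<inter> (A n - A (Suc n))) \<le> 1"
proof -
  have "\<exists>S\<in>positive \<K>. S \<subseteq> A 0 \<and>
      (\<forall>n. finite (S \<inter> (A n - A (Suc n))) \<and> card (S \<inter> (A n - A (Suc n))) \<le> 1)"
    using assms unfolding selective_ideal_def by simp
  then show ?thesis using that by auto
qed

lemma selective_ideal_ideal: "selective_ideal \<K> \<Longrightarrow> ideal_omega \<K>"
  by (simp add: selective_ideal_def)

text \<open>
  Every point of \<open>S\<close> outside \<open>A n\<close> leaves the sequence in one of the first \<open>n\<close> steps, and
  at most one point of \<open>S\<close> leaves in each step.
\<close>

lemma selective_almost_intersection:
  assumes "selective_ideal \<K>" "\<And>n. A (Suc n) \<subseteq> A n" "\<And>n. A n \<notin> \<K>"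
  obtains S where "S \<notin> \<K>" "S \<subseteq> A 0" "\<And>n. finite (S - A n)"
proof -
  obtain S where S: "S \<notin> \<K>" "S \<subseteq> A 0" "\<And>n. finite (S \<inter> (A n - A (Suc n)))"
    using selective_idealD[where A=A, OF assms] by metis
  have "finite (S - A n)" for n
  proof (induction n)
    case 0
    have "S - A 0 = {}" using S(2) by blast
    then show ?case by (simp only: finite.emptyI)
  next
    case (Suc n)
    have "S - A (Suc n) \<subseteq> (S - A n) \<union> (S \<inter> (A n - A (Suc n)))" by blast
    with Suc S(3) show ?case by (meson finite_UnI finite_subset)
  qed
  with S that show ?thesis by blast
qed

lemma selective_injective:
  fixes g :: "nat \<Rightarrow> nat"
  assumes sel: "selective_ideal \<K>" and S: "S \<notin> \<K>" and fibre: "\<And>n. S \<inter> g -` {n} \<in> \<K>"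
  obtains T where "T \<notin> \<K>" "T \<subseteq> S" "inj_on g T"
proof -
  note \<K> = selective_ideal_ideal[OF sel]
  define A where "A = (\<lambda>n. {x \<in> S. n \<le> g x})"
  have "A n \<notin> \<K>" for n
  proof
    assume "A n \<in> \<K>"
    moreover have "(\<Union>i<n. S \<inter> g -` {i}) \<in> \<K>"
      by (intro ideal_UN[OF \<K>] fibre) auto
    ultimately have "A n \<union> (\<Union>i<n. S \<inter> g -` {i}) \<in> \<K>"
      by (rule ideal_Un[OF \<K>])
    then have "S \<in> \<K>"
      by (rule ideal_subset[OF \<K>]) (auto simp: A_def)
    with S show False by blast
  qed
  moreover have "A (Suc n) \<subseteq> A n" for n by (auto simp: A_def)
  ultimately obtain T where T: "T \<notin> \<K>" "T \<subseteq> A 0"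
    "\<And>n. finite (T \<inter> (A n - A (Suc n)))" "\<And>n. card (T \<inter> (A n - A (Suc n))) \<le> 1"
    using selective_idealD[where A=A, OF sel] by metis
  have "T \<subseteq> S" using T(2) by (auto simp: A_def)
  moreover have "inj_on g T"
  proof (rule inj_onI)
    fix x y assume xy: "x \<in> T" "y \<in> T" "g x = g y"
    then have "x \<in> T \<inter> (A (g x) - A (Suc (g x)))" "y \<in> T \<inter> (A (g x) - A (Suc (g x)))"
      using \<open>T \<subseteq> S\<close> by (auto simp: A_def)
    then show "x = y"
      using T(3,4)[of "g x"] by (metis One_nat_def card_le_Suc0_iff_eq)
  qed
  ultimately show ?thesis using T(1) that by blast
qed

lemma selective_constant_or_injective:
  fixes g :: "nat \<Rightarrow> nat"
  assumes "selective_ideal \<K>" "S \<notin> \<K>"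
  obtains T where "T \<notin> \<K>" "T \<subseteq> S" "(\<exists>c. \<forall>x\<in>T. g x = c) \<or> inj_on g T"
proof (cases "\<forall>n. S \<inter> g -` {n} \<in> \<K>")
  case True
  then show ?thesis
    using selective_injective[OF assms, of g] that by metis
next
  case False
  then obtain n where "S \<inter> g -` {n} \<notin> \<K>" by blast
  then show ?thesis using that[of "S \<inter> g -` {n}"] by auto
qed

text \<open>
  Points of the intersection of \<open>A\<close> never leave, and their exit time is an unspecified number.
\<close>

definition exit_time :: "(nat \<Rightarrow> nat set) \<Rightarrow> nat \<Rightarrow> nat" where
  "exit_time A x = (LEAST n. x \<notin> A n)"

lemma exit_time_notin: "x \<notin> (\<Inter>n. A n) \<Longrightarrow> x \<notin> A (exit_time A x)"
  unfolding exit_time_def by (rule LeastI_ex) blast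

lemma exit_time_eq_Suc:
  assumes "\<And>n. A (Suc n) \<subseteq> A n" "x \<in> A n - A (Suc n)"
  shows "exit_time A x = Suc n"
  unfolding exit_time_def
proof (rule Least_equality)
  show "x \<notin> A (Suc n)" using assms by blast
  fix k assume "x \<notin> A k"
  moreover have "x \<in> A k" if "k \<le> n"
    using lift_Suc_antimono_le[of A, OF assms(1) that] assms(2) by blast
  ultimately show "Suc n \<le> k" by fastforce
qed

text \<open>
  A positive intersection of the sequence is itself the required set, and when
  the intersection is in the ideal, its points can be discarded. On the other points of \<open>A 0\<close>
  the differences of the sequence are the fibres of the exit time.
\<close>

lemma selective_idealI:
  assumes \<K>: "ideal_omega \<K>"
    and sel: "\<And>A. (\<And>n. A (Suc n) \<subseteq> A n) \<Longrightarrow> (\<And>n. A n \<notin> \<K>) \<Longrightarrow> (\<Inter>n. A n) \<in> \<K> \<Longrightarrow>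
      \<exists>T. T \<inter> A 0 - (\<Inter>n. A n) \<notin> \<K> \<and> inj_on (exit_time A) T"
  shows "selective_ideal \<K>"
  unfolding selective_ideal_def
proof (intro conjI allI impI \<K>)
  fix A :: "nat \<Rightarrow> nat set"
  assume "(\<forall>n. A (Suc n) \<subseteq> A n) \<and> (\<forall>n. A n \<in> positive \<K>)"
  then have dec: "\<And>n. A (Suc n) \<subseteq> A n" and pos: "\<And>n. A n \<notin> \<K>" by auto
  show "\<exists>S\<in>positive \<K>. S \<subseteq> A 0 \<and>
    (\<forall>n. finite (S \<inter> (A n - A (Suc n))) \<and> card (S \<inter> (A n - A (Suc n))) \<le> 1)"
  proof (cases "(\<Inter>n. A n) \<in> \<K>")
    case False
    have "(\<Inter>n. A n) \<inter> (A k - A (Suc k)) = {}" for k by blast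
    then show ?thesis
      using False by (intro bexI[of _ "\<Inter>n. A n"] conjI allI) (simp_all only: finite.emptyI card.empty, auto)
  next
    case True
    obtain T where T: "T \<inter> A 0 - (\<Inter>n. A n) \<notin> \<K>" "inj_on (exit_time A) T"
      using sel[OF dec pos True] by blast
    define S where "S = T \<inter> A 0 - (\<Inter>n. A n)"
    have eq: "x = y" if "x \<in> S \<inter> (A n - A (Suc n))" "y \<in> S \<inter> (A n - A (Suc n))" for x y n
    proof -
      have "exit_time A x = exit_time A y"
        using exit_time_eq_Suc[of A, OF dec] that by auto
      then show ?thesis using T(2) that by (auto simp: S_def dest: inj_onD)
    qed
    have "finite (S \<inter> (A n - A (Suc n))) \<and> card (S \<inter> (A n - A (Suc n))) \<le> 1" for n
    proof -
      have fin: "finite (S \<inter> (A n - A (Suc n)))"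
      proof (cases "S \<inter> (A n - A (Suc n)) = {}")
        case True
        then show ?thesis by (simp only: finite.emptyI)
      next
        case False
        then obtain x where "x \<in> S \<inter> (A n - A (Suc n))" by blast
        then have "S \<inter> (A n - A (Suc n)) \<subseteq> {x}" using eq by blast
        then show ?thesis by (rule finite_subset) simp
      qed
      moreover have "card (S \<inter> (A n - A (Suc n))) \<le> 1"
        using eq card_le_Suc0_iff_eq[OF fin] by (metis One_nat_def)
      ultimately show ?thesis by blast
    qed
    moreover have "S \<in> positive \<K>" "S \<subseteq> A 0" using T(1) by (auto simp: S_def)
    ultimately show ?thesis by blast
  qed
qed

section \<open>Selectivity as the failure of ED to lie below countable extensions\<close>

text \<open>
  Finitely many members of \<open>\<A>\<close> and fibres of a witness \<open>g\<close> never cover \<open>\<omega>\<close> modulo \<open>\<K>\<close>,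
  so selectivity gives a positive set \<open>S\<close> almost disjoint from all of them. A
  positive subset of \<open>S\<close> on which \<open>g\<close> is injective is almost disjoint from the members of \<open>\<A>\<close>, hence
  does not become small in the extension.
\<close>

lemma selective_extension_not_above_ED:
  assumes sel: "selective_ideal \<K>" and count: "countable \<A>"
    and proper: "UNIV \<notin> ideal_extension \<K> \<A>"
  shows "\<not> le_via UNIV ED (ideal_extension \<K> \<A>)"
proof
  note \<K> = selective_ideal_ideal[OF sel]
  note ext = ideal_extension_ideal[OF \<K> proper]
  assume "le_via UNIV ED (ideal_extension \<K> \<A>)"
  then obtain g :: "nat \<Rightarrow> nat" where fibre: "\<And>n. g -` {n} \<in> ideal_extension \<K> \<A>"
    and inj: "\<And>T. inj_on g T \<Longrightarrow> T \<in> ideal_extension \<K> \<A>"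
    unfolding ED_below_iff[OF ext] by blast
  define \<C> where "\<C> = \<A> \<union> range (\<lambda>n. g -` {n})"
  have \<C>: "countable \<C>" "\<C> \<noteq> {}" "\<C> \<subseteq> ideal_extension \<K> \<A>"
    using count fibre ideal_extension_generators[OF \<K>] by (auto simp: \<C>_def)
  define c where "c = from_nat_into \<C>"
  have c: "range c = \<C>"
    unfolding c_def using \<C>(1,2) by (rule range_from_nat_into[rotated])
  define A where "A = (\<lambda>n. - (\<Union>i<n. c i))"
  have "A n \<notin> \<K>" for n
  proof
    assume "A n \<in> \<K>"
    then have "A n \<in> ideal_extension \<K> \<A>" using ideal_extension_superset by blast
    moreover have "(\<Union>i<n. c i) \<in> ideal_extension \<K> \<A>"
      using \<C>(3) c by (intro ideal_UN[OF ext]) auto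
    ultimately have "A n \<union> (\<Union>i<n. c i) \<in> ideal_extension \<K> \<A>"
      by (rule ideal_Un[OF ext])
    moreover have "A n \<union> (\<Union>i<n. c i) = UNIV"
      unfolding A_def by blast
    ultimately show False using proper by simp
  qed
  moreover have "A (Suc n) \<subseteq> A n" for n by (auto simp: A_def)
  ultimately obtain S where S: "S \<notin> \<K>" "\<And>n. finite (S - A n)"
    using selective_almost_intersection[where A=A, OF sel] by metis
  have almost_disjoint: "finite (S \<inter> C)" if "C \<in> \<C>" for C
  proof -
    from that c obtain i where "C = c i" by blast
    then have "S \<inter> C \<subseteq> S - A (Suc i)" by (auto simp: A_def)
    then show ?thesis using S(2) by (rule finite_subset)
  qed
  have "S \<inter> g -` {n} \<in> \<K>" for n
    by (intro ideal_finite[OF \<K>] almost_disjoint) (simp add: \<C>_def)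
  then obtain T where T: "T \<notin> \<K>" "T \<subseteq> S" "inj_on g T"
    using selective_injective[OF sel S(1)] by metis
  from inj[OF T(3)] obtain F where F: "finite F" "F \<subseteq> \<A>" "T - \<Union>F \<in> \<K>"
    unfolding ideal_extension_def by blast
  have "finite (\<Union>C\<in>F. S \<inter> C)"
    using F(1,2) by (intro finite_UN_I almost_disjoint) (auto simp: \<C>_def)
  then have "finite (T - (T - \<Union>F))"
    by (rule rev_finite_subset) (use T(2) in blast)
  with F(3) have "T \<in> \<K>" by (rule ideal_almost_subset[OF \<K>])
  with T(1) show False by blast
qed

text \<open>
  Given a decreasing sequence \<open>A\<close> of positive sets, the complements of the \<open>A n\<close> generate a proper
  extension that contains the fibres of the exit time. A set positive for the extension on which the
  exit time is injective stays positive when it is cut down to \<open>A 0\<close> minus the intersection of the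
  sequence, because only members of the extension are removed.
\<close>

lemma selective_if_extensions_not_above_ED:
  assumes \<K>: "ideal_omega \<K>"
    and not_above: "\<And>\<A>. countable \<A> \<Longrightarrow> UNIV \<notin> ideal_extension \<K> \<A> \<Longrightarrow>
      \<not> le_via UNIV ED (ideal_extension \<K> \<A>)"
  shows "selective_ideal \<K>"
proof (rule selective_idealI[OF \<K>])
  fix A :: "nat \<Rightarrow> nat set"
  assume dec: "\<And>n. A (Suc n) \<subseteq> A n" and pos: "\<And>n. A n \<notin> \<K>" and Int: "(\<Inter>n. A n) \<in> \<K>"
  define \<A> where "\<A> = range (\<lambda>n. - A n)"
  have proper: "UNIV \<notin> ideal_extension \<K> \<A>"
  proof
    assume "UNIV \<in> ideal_extension \<K> \<A>"
    then obtain F where F: "finite F" "F \<subseteq> \<A>" "UNIV - \<Union>F \<in> \<K>"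
      unfolding ideal_extension_def by blast
    then obtain N where N: "finite N" "F = (\<lambda>n. - A n) ` N"
      unfolding \<A>_def by (meson finite_subset_image)
    have "A (Max (insert 0 N)) \<subseteq> A n" if "n \<in> N" for n
      using N(1) that by (intro lift_Suc_antimono_le[of A, OF dec]) auto
    then have "A (Max (insert 0 N)) \<subseteq> UNIV - \<Union>F"
      using N(2) by blast
    with F(3) pos show False using ideal_subset[OF \<K>] by blast
  qed
  note ext = ideal_extension_ideal[OF \<K> proper]
  have comp: "- A n \<in> ideal_extension \<K> \<A>" for n
    using ideal_extension_generators[OF \<K>, of \<A>] by (auto simp: \<A>_def)
  have Int': "(\<Inter>n. A n) \<in> ideal_extension \<K> \<A>"
    using Int ideal_extension_superset by blast
  have "exit_time A -` {n} \<in> ideal_extension \<K> \<A>" for n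
  proof (rule ideal_subset[OF ext ideal_Un[OF ext comp[of n] Int']])
    show "exit_time A -` {n} \<subseteq> - A n \<union> (\<Inter>n. A n)"
      using exit_time_notin[of _ A] by blast
  qed
  moreover have "\<not> le_via UNIV ED (ideal_extension \<K> \<A>)"
    using proper by (intro not_above) (simp_all add: \<A>_def)
  ultimately obtain T where T: "inj_on (exit_time A) T" "T \<notin> ideal_extension \<K> \<A>"
    unfolding ED_below_iff[OF ext] by blast
  have "T \<inter> A 0 - (\<Inter>n. A n) \<notin> \<K>"
  proof
    assume "T \<inter> A 0 - (\<Inter>n. A n) \<in> \<K>"
    then have "T \<inter> A 0 - (\<Inter>n. A n) \<in> ideal_extension \<K> \<A>"
      using ideal_extension_superset by blast
    then have "(T \<inter> A 0 - (\<Inter>n. A n)) \<union> (- A 0 \<union> (\<Inter>n. A n)) \<in> ideal_extension \<K> \<A>"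
      using comp Int' by (blast intro: ideal_Un[OF ext])
    then have "T \<in> ideal_extension \<K> \<A>"
      by (rule ideal_subset[OF ext]) blast
    with T(2) show False by blast
  qed
  with T(1) show "\<exists>T. T \<inter> A 0 - (\<Inter>n. A n) \<notin> \<K> \<and> inj_on (exit_time A) T" by blast
qed

lemma not_preceq_ED_iff:
  "\<not> preceq_omega1 UNIV G ED \<J> \<longleftrightarrow> (\<exists>\<K>. selective_ideal \<K> \<and> le_via G \<J> \<K>)"
proof
  assume "\<not> preceq_omega1 UNIV G ED \<J>"
  then obtain \<K> where "ideal_omega \<K>" "le_via G \<J> \<K>"
    "\<And>\<A>. countable \<A> \<Longrightarrow> UNIV \<notin> ideal_extension \<K> \<A> \<Longrightarrow> \<not> le_via UNIV ED (ideal_extension \<K> \<A>)"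
    unfolding preceq_omega1_def by blast
  then show "\<exists>\<K>. selective_ideal \<K> \<and> le_via G \<J> \<K>"
    using selective_if_extensions_not_above_ED by blast
next
  assume "\<exists>\<K>. selective_ideal \<K> \<and> le_via G \<J> \<K>"
  then show "\<not> preceq_omega1 UNIV G ED \<J>"
    unfolding preceq_omega1_def
    using selective_extension_not_above_ED selective_ideal_ideal by blast
qed

section \<open>Replacing a map by an inclusion\<close>

lemma le_via_mono: "F \<subseteq> G \<Longrightarrow> le_via F \<I> \<K> \<Longrightarrow> le_via G \<I> \<K>"
  unfolding le_via_def by blast

lemma le_via_one_to_one_if_subset:
  assumes "\<I> \<subseteq> \<K>"
  shows "le_via one_to_one \<I> \<K>"
  unfolding le_via_def one_to_one_def using assms by (intro bexI[of _ id]) auto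

lemma one_to_one_subset_fin_to_one: "one_to_one \<subseteq> fin_to_one"
  unfolding one_to_one_def fin_to_one_def by (auto intro: finite_vimageI)

text \<open>
  The fibres of a witness \<open>f\<close> lie in \<open>\<K>\<close>, since finite sets lie in \<open>\<J>\<close>. Hence \<open>f\<close> is injective on a
  \<open>\<K>\<close>-positive set \<open>S\<close>, where it merely renames points: the image of \<open>\<K>\<close> restricted to \<open>S\<close>
  inherits selectivity.
\<close>

lemma extendable_if_below_selective:
  assumes \<J>: "ideal_omega \<J>" and sel: "selective_ideal \<K>" and below: "le_via G \<J> \<K>"
  shows "extendable_to_selective \<J>"
proof -
  note \<K> = selective_ideal_ideal[OF sel]
  obtain f where f: "\<And>B. B \<in> \<J> \<Longrightarrow> f -` B \<in> \<K>"
    using below unfolding le_via_def by blast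
  have "UNIV \<inter> f -` {n} \<in> \<K>" for n
    using f[of "{n}"] ideal_finite[OF \<J>] by simp
  then obtain S where S: "S \<notin> \<K>" "inj_on f S"
    using selective_injective[OF sel ideal_UNIV[OF \<K>]] by metis
  define \<J>' where "\<J>' = {B. f -` B \<inter> S \<in> \<K>}"
  have sub: "\<J> \<subseteq> \<J>'"
    using f ideal_subset[OF \<K>] by (fastforce simp: \<J>'_def)
  have ideal: "ideal_omega \<J>'"
    unfolding ideal_on_def
  proof (intro conjI ballI allI impI)
    fix A B assume "A \<in> \<J>'" "B \<in> \<J>'"
    then show "A \<union> B \<in> \<J>'"
      using ideal_Un[OF \<K>] by (simp add: \<J>'_def Int_Un_distrib2)
  next
    fix A B assume "A \<in> \<J>'" "B \<subseteq> A"
    then show "B \<in> \<J>'"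
      using ideal_subset[OF \<K>, of "f -` A \<inter> S" "f -` B \<inter> S"] by (auto simp: \<J>'_def)
  next
    fix A :: "nat set" assume "A \<subseteq> UNIV \<and> finite A"
    then show "A \<in> \<J>'" using sub ideal_finite[OF \<J>] by blast
  qed (use S(1) in \<open>auto simp: \<J>'_def\<close>)
  have "selective_ideal \<J>'"
    unfolding selective_ideal_def
  proof (intro conjI allI impI ideal)
    fix A :: "nat \<Rightarrow> nat set"
    assume A: "(\<forall>n. A (Suc n) \<subseteq> A n) \<and> (\<forall>n. A n \<in> positive \<J>')"
    define C where "C = (\<lambda>n. f -` A n \<inter> S)"
    have "C (Suc n) \<subseteq> C n" "C n \<notin> \<K>" for n
      using A by (auto simp: C_def \<J>'_def)
    then obtain T where T: "T \<notin> \<K>" "T \<subseteq> C 0"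
      "\<And>n. finite (T \<inter> (C n - C (Suc n)))" "\<And>n. card (T \<inter> (C n - C (Suc n))) \<le> 1"
      using selective_idealD[where A=C, OF sel] by metis
    have "f ` T \<inter> (A n - A (Suc n)) = f ` (T \<inter> (C n - C (Suc n)))" for n
      using T(2) by (auto simp: C_def)
    then have "finite (f ` T \<inter> (A n - A (Suc n))) \<and> card (f ` T \<inter> (A n - A (Suc n))) \<le> 1" for n
      using T(3,4)[of n] card_image_le[OF T(3)[of n], of f] by simp
    moreover have "f ` T \<notin> \<J>'"
      using T(1,2) ideal_subset[OF \<K>, of "f -` (f ` T) \<inter> S" T] by (auto simp: \<J>'_def C_def)
    moreover have "f ` T \<subseteq> A 0" using T(2) by (auto simp: C_def)
    ultimately show "\<exists>S\<in>positive \<J>'. S \<subseteq> A 0 \<and>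
      (\<forall>n. finite (S \<inter> (A n - A (Suc n))) \<and> card (S \<inter> (A n - A (Suc n))) \<le> 1)"
      by (intro bexI[of _ "f ` T"]) auto
  qed
  with sub show ?thesis unfolding extendable_to_selective_def by blast
qed

lemma extendable_iff_below_selective:
  assumes "ideal_omega \<J>" "one_to_one \<subseteq> G"
  shows "extendable_to_selective \<J> \<longleftrightarrow> (\<exists>\<K>. selective_ideal \<K> \<and> le_via G \<J> \<K>)"
  using extendable_if_below_selective[OF assms(1)]
    le_via_one_to_one_if_subset le_via_mono[OF assms(2)]
  unfolding extendable_to_selective_def by meson

section \<open>Selective ultrafilters under CH\<close>

lemma dual_ideal_iff: "A \<in> dual_ideal \<U> \<longleftrightarrow> - A \<in> \<U>"
  unfolding dual_ideal_def by (auto intro: exI[of _ "- A"])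

lemma ultrafilter_Compl_iff:
  assumes "ultrafilter_omega \<U>"
  shows "- A \<in> \<U> \<longleftrightarrow> A \<notin> \<U>"
  using assms unfolding ultrafilter_omega_def by (metis Compl_disjoint)

lemma ultrafilter_dual_ideal:
  assumes "ultrafilter_omega \<U>"
  shows "ideal_omega (dual_ideal \<U>)"
  using assms unfolding ultrafilter_omega_def ideal_on_def dual_ideal_iff
  by (simp add: dual_ideal_iff Compl_Un)

lemma selective_ultrafilterI:
  assumes U: "ultrafilter_omega \<U>"
    and dec: "\<And>g :: nat \<Rightarrow> nat. \<exists>X\<in>\<U>. (\<exists>c. \<forall>x\<in>X. g x = c) \<or> inj_on g X"
  shows "selective_ultrafilter \<U>"
  unfolding selective_ultrafilter_def
proof (intro conjI U selective_idealI ultrafilter_dual_ideal[OF U])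
  have dual: "A \<notin> dual_ideal \<U> \<longleftrightarrow> A \<in> \<U>" for A
    using ultrafilter_Compl_iff[OF U] by (simp add: dual_ideal_iff)
  have Int: "A \<inter> B \<in> \<U>" if "A \<in> \<U>" "B \<in> \<U>" for A B
    using U that by (simp add: ultrafilter_omega_def)
  fix A :: "nat \<Rightarrow> nat set"
  assume "\<And>n. A n \<notin> dual_ideal \<U>" and I: "(\<Inter>n. A n) \<in> dual_ideal \<U>"
  then have A: "\<And>n. A n \<in> \<U>" using dual by blast
  have I: "- (\<Inter>n. A n) \<in> \<U>" by (rule I[unfolded dual_ideal_iff])
  obtain X where X: "X \<in> \<U>" "(\<exists>c. \<forall>x\<in>X. exit_time A x = c) \<or> inj_on (exit_time A) X"
    using dec by blast
  \<comment> \<open>on \<open>A c\<close> outside the intersection, the exit time never takes the value \<open>c\<close>\<close>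
  have "\<not> (\<forall>x\<in>X. exit_time A x = c)" for c
  proof
    assume c: "\<forall>x\<in>X. exit_time A x = c"
    have "X \<inter> A c \<inter> - (\<Inter>n. A n) \<in> \<U>"
      by (intro Int X(1) A I)
    moreover have "x \<notin> X \<inter> A c \<inter> - (\<Inter>n. A n)" for x
      using exit_time_notin[of x A] c by (metis ComplD IntE)
    then have "X \<inter> A c \<inter> - (\<Inter>n. A n) = {}" by blast
    ultimately show False using U by (simp add: ultrafilter_omega_def)
  qed
  then have "inj_on (exit_time A) X" using X(2) by blast
  moreover have "X \<inter> A 0 \<inter> - (\<Inter>n. A n) \<in> \<U>"
    by (intro Int X(1) A I)
  then have "X \<inter> A 0 - (\<Inter>n. A n) \<notin> dual_ideal \<U>"
    by (simp only: dual Diff_eq)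
  ultimately show "\<exists>T. T \<inter> A 0 - (\<Inter>n. A n) \<notin> dual_ideal \<U> \<and> inj_on (exit_time A) T"
    by blast
qed

text \<open>
  Functions are coded by their graphs, so there are at most \<open>\<aleph>\<^sub>1\<close> of them; in the
  well-order of least type every proper initial segment has smaller cardinality.
\<close>

lemma CH_well_order_of_functions:
  includes cardinal_syntax
  assumes CH
  obtains R :: "(nat \<Rightarrow> nat) rel"
  where "wf R" "trans R" "total R" "\<And>f. countable {g. (g, f) \<in> R}"
proof -
  define r where "r = card_of (UNIV :: (nat \<Rightarrow> nat) set)"
  have co: "Card_order r" and Field: "Field r = UNIV"
    unfolding r_def by (rule card_of_Card_order, rule Field_card_of)
  then have wo: "Well_order r" by (simp add: card_order_on_well_order_on)
  have "inj (\<lambda>f :: nat \<Rightarrow> nat. prod_encode ` {(n, f n) | n. True})"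
  proof (rule injI)
    fix f g :: "nat \<Rightarrow> nat"
    assume "prod_encode ` {(n, f n) | n. True} = prod_encode ` {(n, g n) | n. True}"
    then have "{(n, f n) | n. True} = {(n, g n) | n. True}"
      by (simp add: inj_image_eq_iff inj_prod_encode)
    then show "f = g" by (auto simp: set_eq_iff)
  qed
  then have "r \<le>o card_of (UNIV :: nat set set)"
    unfolding r_def card_of_ordLeq[symmetric] by blast
  also have "card_of (UNIV :: nat set set) =o cardSuc natLeq"
    using assms by (simp add: CH_def)
  finally have le: "r \<le>o cardSuc natLeq" .
  have count: "countable {g. (g, f) \<in> r - Id}" for f
  proof -
    have "{g. (g, f) \<in> r - Id} = underS r f"
      by (auto simp: underS_def)
    moreover have "card_of (underS r f) <o r"
      using co Field by (intro card_of_underS) auto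
    then have "card_of (underS r f) <o cardSuc natLeq"
      using le by (rule ordLess_ordLeq_trans)
    then have "card_of (underS r f) \<le>o natLeq"
      by (rule cardSuc_ordLeq_ordLess[OF natLeq_Card_order card_of_Card_order, THEN iffD1])
    then have "countable (underS r f)"
      by (rule countable_card_le_natLeq[THEN iffD2])
    ultimately show ?thesis by simp
  qed
  have lin: "linear_order r" and wf: "wf (r - Id)"
    using wo Field by (simp_all add: well_order_on_def)
  then have "trans (r - Id)" "total (r - Id)"
    by (auto simp: linear_order_on_def partial_order_on_def preorder_on_def intro: trans_diff_Id)
  with wf count that show ?thesis by blast
qed

lemma finite_has_maximum:
  assumes "finite E" "E \<noteq> {}" "trans R" "total R"
  shows "\<exists>k\<in>E. \<forall>g\<in>E. g = k \<or> (g, k) \<in> R"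
  using assms(1,2)
proof (induction rule: finite_ne_induct)
  case (insert x E)
  then obtain k where k: "k \<in> E" "\<forall>g\<in>E. g = k \<or> (g, k) \<in> R" by blast
  have "x = k \<or> (x, k) \<in> R \<or> (k, x) \<in> R"
    using assms(4) by (auto simp: total_on_def)
  then consider "x = k \<or> (x, k) \<in> R" | "(k, x) \<in> R" by blast
  then show ?case
  proof cases
    case 2
    then have "\<forall>g\<in>insert x E. g = x \<or> (g, x) \<in> R"
      using k(2) assms(3) by (auto dest: transD)
    then show ?thesis by blast
  qed (use k in blast)
qed simp

text \<open>
  At each step the sets already chosen form a countable almost decreasing chain, so finite
  intersections of them contain a member of the chain up to a finite set and are positive.
  Selectivity gives a positive set almost contained in all of them, which is then shrunk to
  one on which the current function is constant or injective.
\<close>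

lemma CH_deciding_tower:
  assumes CH and sel: "selective_ideal \<K>"
  obtains R :: "(nat \<Rightarrow> nat) rel" and F where "total R"
    "\<And>f. F f \<notin> \<K>" "\<And>f g. (g, f) \<in> R \<Longrightarrow> finite (F f - F g)"
    "\<And>f. (\<exists>c. \<forall>x\<in>F f. f x = c) \<or> inj_on f (F f)"
proof -
  note \<K> = selective_ideal_ideal[OF sel]
  obtain R :: "(nat \<Rightarrow> nat) rel" where R: "wf R" "trans R" "total R"
    and count: "\<And>f. countable {g. (g, f) \<in> R}"
    using CH_well_order_of_functions[OF assms(1)] by metis
  define P where "P = (\<lambda>F f s. s \<notin> \<K> \<and> (\<forall>g. (g, f) \<in> R \<longrightarrow> finite (s - F g)) \<and>
    ((\<exists>c. \<forall>x\<in>s. f x = c) \<or> inj_on f s))"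
  have "\<exists>F. \<forall>f. P F f (F f)"
  proof (rule dependent_wf_choice[OF R(1)])
    show "P F f s = P G f s" if "\<And>z. (z, f) \<in> R \<Longrightarrow> F z = G z" for F G f s
      using that by (auto simp: P_def)
  next
    fix f F assume IH: "\<And>g. (g, f) \<in> R \<Longrightarrow> P F g (F g)"
    define D where "D = {g. (g, f) \<in> R}"
    define A where "A = (\<lambda>n. \<Inter>g\<in>{g \<in> D. to_nat_on D g < n}. F g)"
    have inj: "inj_on (to_nat_on D) D"
      unfolding D_def by (rule inj_on_to_nat_on) (rule count)
    have "A n \<notin> \<K>" for n
    proof (cases "{g \<in> D. to_nat_on D g < n} = {}")
      case True
      then have "A n = UNIV" unfolding A_def by (simp only: INF_empty)
      then show ?thesis using ideal_UNIV[OF \<K>] by simp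
    next
      case False
      have fin: "finite {g \<in> D. to_nat_on D g < n}"
      proof (rule finite_imageD)
        show "finite (to_nat_on D ` {g \<in> D. to_nat_on D g < n})"
          by (rule finite_subset[of _ "{..<n}"]) auto
        show "inj_on (to_nat_on D) {g \<in> D. to_nat_on D g < n}"
          using inj by (rule inj_on_subset) blast
      qed
      obtain k where k: "k \<in> D" "\<And>g. g \<in> D \<Longrightarrow> to_nat_on D g < n \<Longrightarrow> g = k \<or> (g, k) \<in> R"
        using finite_has_maximum[OF fin False R(2,3)] by blast
      have Pk: "P F k (F k)" using IH k(1) by (simp add: D_def)
      have "finite (\<Union>g\<in>{g \<in> D. to_nat_on D g < n}. F k - F g)"
      proof (rule finite_UN_I[OF fin])
        fix g assume "g \<in> {g \<in> D. to_nat_on D g < n}"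
        then show "finite (F k - F g)" using k(2)[of g] Pk by (auto simp: P_def)
      qed
      moreover have "(\<Union>g\<in>{g \<in> D. to_nat_on D g < n}. F k - F g) = F k - A n"
        unfolding A_def by blast
      ultimately have "finite (F k - A n)" by simp
      then show ?thesis
        using Pk ideal_almost_subset[OF \<K>] by (auto simp: P_def)
    qed
    moreover have "A (Suc n) \<subseteq> A n" for n
      unfolding A_def by (intro INF_superset_mono) auto
    ultimately obtain S where S: "S \<notin> \<K>" "\<And>n. finite (S - A n)"
      using selective_almost_intersection[where A=A, OF sel] by metis
    obtain T where T: "T \<notin> \<K>" "T \<subseteq> S" "(\<exists>c. \<forall>x\<in>T. f x = c) \<or> inj_on f T"
      using selective_constant_or_injective[OF sel S(1)] by metis
    have "finite (T - F g)" if "(g, f) \<in> R" for g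
    proof -
      have "A (Suc (to_nat_on D g)) \<subseteq> F g"
        using that unfolding A_def by (intro INF_lower) (simp add: D_def)
      then have "T - F g \<subseteq> S - A (Suc (to_nat_on D g))"
        using T(2) by blast
      then show ?thesis using S(2) by (rule finite_subset)
    qed
    with T show "\<exists>s. P F f s" by (auto simp: P_def)
  qed
  then obtain F where "\<And>f. P F f (F f)" by blast
  then show ?thesis
    using that[OF R(3), of F] by (simp add: P_def)
qed

text \<open>
  The tower decides every set \<open>X\<close> because it decides the indicator function of \<open>X\<close>, which is not
  injective on an infinite set.
\<close>

lemma CH_selective_ultrafilter_extending:
  assumes CH and sel: "selective_ideal \<K>"
  obtains \<U> where "selective_ultrafilter \<U>" "\<K> \<subseteq> dual_ideal \<U>"
proof -
  note \<K> = selective_ideal_ideal[OF sel]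
  obtain R :: "(nat \<Rightarrow> nat) rel" and F where R: "total R" and pos: "\<And>f. F f \<notin> \<K>"
    and tower: "\<And>f g. (g, f) \<in> R \<Longrightarrow> finite (F f - F g)"
    and dec: "\<And>f. (\<exists>c. \<forall>x\<in>F f. f x = c) \<or> inj_on f (F f)"
    using CH_deciding_tower[OF assms] by metis
  define \<U> where "\<U> = {X. \<exists>f. finite (F f - X)}"
  have disjoint: "X \<notin> \<K>" if "X \<in> \<U>" for X
    using that pos ideal_almost_subset[OF \<K>] by (auto simp: \<U>_def)
  have U: "ultrafilter_omega \<U>"
    unfolding ultrafilter_omega_def
  proof (intro conjI ballI allI impI)
    show "{} \<notin> \<U>" using disjoint ideal_finite[OF \<K>] by blast
  next
    fix A B assume "A \<in> \<U>" "B \<in> \<U>"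
    then obtain f g where fg: "finite (F f - A)" "finite (F g - B)"
      by (auto simp: \<U>_def)
    have "f = g \<or> (f, g) \<in> R \<or> (g, f) \<in> R"
      using R by (auto simp: total_on_def)
    then obtain h where "h = f \<or> (f, h) \<in> R" "h = g \<or> (g, h) \<in> R" by blast
    then have "finite (F h - F f)" "finite (F h - F g)"
      using tower by auto
    moreover have "F h - A \<inter> B \<subseteq> (F h - F f) \<union> (F f - A) \<union> ((F h - F g) \<union> (F g - B))"
      by blast
    ultimately have "finite (F h - A \<inter> B)"
      using fg by (meson finite_UnI finite_subset)
    then show "A \<inter> B \<in> \<U>" by (auto simp: \<U>_def)
  next
    fix A B assume "A \<in> \<U>" "A \<subseteq> B"
    then show "B \<in> \<U>"
      unfolding \<U>_def using Diff_mono[OF order_refl \<open>A \<subseteq> B\<close>]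
      by (blast intro: finite_subset)
  next
    fix A :: "nat set" assume "finite (- A)"
    moreover have "F f - A \<subseteq> - A" for f by blast
    ultimately show "A \<in> \<U>" unfolding \<U>_def by (blast intro: finite_subset)
  next
    fix A :: "nat set"
    define i :: "nat \<Rightarrow> nat" where "i = (\<lambda>x. if x \<in> A then 1 else 0)"
    have "\<not> inj_on i (F i)"
    proof
      assume "inj_on i (F i)"
      moreover have "finite (i ` F i)"
        by (rule finite_subset[of _ "{0, 1}"]) (auto simp: i_def)
      ultimately have "finite (F i)" by (rule finite_imageD[rotated])
      with pos ideal_finite[OF \<K>] show False by blast
    qed
    with dec obtain c where "\<forall>x\<in>F i. i x = c" by blast
    then have "F i \<subseteq> A \<or> F i \<subseteq> - A"
      unfolding i_def by (metis ComplI subsetI zero_neq_one)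
    then have "F i - A = {} \<or> F i - (- A) = {}" by blast
    then show "A \<in> \<U> \<or> - A \<in> \<U>"
      unfolding \<U>_def by (metis (mono_tags, lifting) finite.emptyI mem_Collect_eq)
  qed
  have "F f \<in> \<U>" for f
  proof -
    have "finite (F f - F f)" by simp
    then show ?thesis unfolding \<U>_def by blast
  qed
  then have "\<exists>X\<in>\<U>. (\<exists>c. \<forall>x\<in>X. g x = c) \<or> inj_on g X" for g :: "nat \<Rightarrow> nat"
    using dec[of g] by (intro bexI[of _ "F g"])
  then have "selective_ultrafilter \<U>"
    by (rule selective_ultrafilterI[OF U])
  moreover have "\<K> \<subseteq> dual_ideal \<U>"
    unfolding dual_ideal_iff subset_iff ultrafilter_Compl_iff[OF U] using disjoint by blast
  ultimately show ?thesis using that by blast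
qed

lemma CH_extendable_iff_selective_ultrafilter:
  assumes CH "ideal_omega \<J>" "one_to_one \<subseteq> G"
  shows "extendable_to_selective \<J> \<longleftrightarrow>
    (\<exists>\<U>. selective_ultrafilter \<U> \<and> le_via G \<J> (dual_ideal \<U>))"
proof
  assume "extendable_to_selective \<J>"
  then obtain \<K> where "selective_ideal \<K>" "\<J> \<subseteq> \<K>"
    unfolding extendable_to_selective_def by blast
  moreover obtain \<U> where "selective_ultrafilter \<U>" "\<K> \<subseteq> dual_ideal \<U>"
    using CH_selective_ultrafilter_extending[OF assms(1) \<open>selective_ideal \<K>\<close>] by blast
  ultimately show "\<exists>\<U>. selective_ultrafilter \<U> \<and> le_via G \<J> (dual_ideal \<U>)"
    using le_via_mono[OF assms(3) le_via_one_to_one_if_subset] by blast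
next
  assume "\<exists>\<U>. selective_ultrafilter \<U> \<and> le_via G \<J> (dual_ideal \<U>)"
  then show "extendable_to_selective \<J>"
    using extendable_if_below_selective[OF assms(2)]
    unfolding selective_ultrafilter_def by blast
qed

theorem theorem9p3:
  fixes \<J> :: "nat set set"
  assumes "ideal_omega \<J>"
  shows
    "((extendable_to_selective \<J> \<longleftrightarrow> \<not> preceq_omega1 UNIV one_to_one ED \<J>) \<and>
      (extendable_to_selective \<J> \<longleftrightarrow> \<not> preceq_omega1 UNIV fin_to_one ED \<J>) \<and>
      (extendable_to_selective \<J> \<longleftrightarrow> \<not> preceq_omega1 UNIV UNIV ED \<J>)) \<and>
     (CH \<longrightarrow>
      (extendable_to_selective \<J> \<longleftrightarrow>
         (\<exists>\<U>. selective_ultrafilter \<U> \<and> \<not> J_point \<J> \<U>)) \<and>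
      (extendable_to_selective \<J> \<longleftrightarrow>
         (\<exists>\<U>. selective_ultrafilter \<U> \<and> \<not> weak_J_ultrafilter \<J> \<U>)) \<and>
      (extendable_to_selective \<J> \<longleftrightarrow>
         (\<exists>\<U>. selective_ultrafilter \<U> \<and> \<not> J_ultrafilter \<J> \<U>)))"
  unfolding J_point_def weak_J_ultrafilter_def J_ultrafilter_def not_not not_preceq_ED_iff
  by (intro conjI impI extendable_iff_below_selective
      CH_extendable_iff_selective_ultrafilter assms one_to_one_subset_fin_to_one
      order_refl subset_UNIV)

end
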